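(* A cograph $G$ is maximally connected if and only if $G$ has a primary cocomponent which has an isolated vertex.
   Context: Graphs are finite, simple and undirected. The order of a graph is its number of vertices; $\delta(G)$ is the minimum degree. An isolated vertex of a graph is a vertex of degree $0$ in that graph. Cographs are defined recursively: $K_1$ is a cograph; the disjoint union of cographs is a cograph; the join of cographs is a cograph, where the join $G_1+G_2$ of vertex-disjoint graphs is obtained from their disjoint union by adding all edges between $V(G_1)$ and $V(G_2)$. (Equivalently, cographs are the graphs with no induced path $P_4$ on four vertices.) A nontrivial connected cograph $G$ (nontrivial means of order at least 2) decomposes uniquely as a join $G=G_1+\cdots+G_t$ with $t\ge 2$ in which each $G_i$ is either $K_1$ or a disconnected cograph; the $G_i$ are the cocomponents of $G$, and a cocomponent of largest order is called a primary cocomponent (there may be several). If $G\cong K_1$ or $G$ is a disconnected cograph, then $G$ itself is regarded as its only, primary, cocomponent. The connectivity $\kappa(G)$ is the minimum number of vertices whose removal from $G$ results in a disconnected graph or a trivial graph (a graph of order 1); in particular $\kappa(K_1)=0$. $G$ is maximally connected if $\kappa(G)=\delta(G)$. *)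

theory Defs
  imports "Graph_Theory.Digraph_Component"
begin

text \<open>
  A finite simple undirected graph is a \<^typ>\<open>'a pair_pre_digraph\<close> satisfying
  \<^locale>\<open>pair_graph\<close>: finite, without loops, and with a symmetric arc relation, the
  edge between \<open>u\<close> and \<open>v\<close> being the two arcs \<open>(u, v)\<close> and \<open>(v, u)\<close>.
\<close>

definition trivial_graph :: "('a, 'b) pre_digraph \<Rightarrow> bool" where
  "trivial_graph G \<longleftrightarrow> card (verts G) = 1"

text \<open>The null graph is neither connected (in the sense of \<^const>\<open>connected\<close>) nor disconnected.\<close>

definition disconnected :: "('a, 'b) pre_digraph \<Rightarrow> bool" where
  "disconnected G \<longleftrightarrow> verts G \<noteq> {} \<and> \<not> connected G"

definition graph_union :: "'a pair_pre_digraph \<Rightarrow> 'a pair_pre_digraph \<Rightarrow> 'a pair_pre_digraph" where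
  "graph_union G H = \<lparr> pverts = pverts G \<union> pverts H, parcs = parcs G \<union> parcs H \<rparr>"

definition graph_join :: "'a pair_pre_digraph \<Rightarrow> 'a pair_pre_digraph \<Rightarrow> 'a pair_pre_digraph" where
  "graph_join G H = \<lparr> pverts = pverts G \<union> pverts H,
     parcs = parcs G \<union> parcs H \<union> pverts G \<times> pverts H \<union> pverts H \<times> pverts G \<rparr>"

inductive cograph :: "'a pair_pre_digraph \<Rightarrow> bool" where
  cograph_K1: "cograph \<lparr> pverts = {v}, parcs = {} \<rparr>"
| cograph_union: "cograph G \<Longrightarrow> cograph H \<Longrightarrow> pverts G \<inter> pverts H = {} \<Longrightarrow>
    cograph (graph_union G H)"
| cograph_join: "cograph G \<Longrightarrow> cograph H \<Longrightarrow> pverts G \<inter> pverts H = {} \<Longrightarrow>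
    cograph (graph_join G H)"

lemma cograph_imp_pair_graph:
  assumes "cograph G"
  shows "pair_graph G \<and> pverts G \<noteq> {}"
proof -
  have "finite (pverts G) \<and> pverts G \<noteq> {} \<and> parcs G \<subseteq> pverts G \<times> pverts G \<and>
    sym (parcs G) \<and> irrefl (parcs G)"
    using assms
  proof (induction rule: cograph.induct)
    case (cograph_K1 v)
    then show ?case by (auto simp: sym_def irrefl_def)
  next
    case (cograph_union G H)
    then show ?case by (auto simp: graph_union_def sym_def irrefl_def)
  next
    case (cograph_join G H)
    then show ?case
      unfolding graph_join_def sym_def irrefl_def by (simp, safe) blast+
  qed
  then show ?thesis
    by (auto simp: symmetric_def irrefl_def intro!: pair_graph.intro pair_digraph.intro
        pair_fin_digraph.intro pair_pseudo_graph.intro pair_sym_digraph.intro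
        pair_loopfree_digraph.intro pair_wf_digraph.intro pair_fin_digraph_axioms.intro
        pair_sym_digraph_axioms.intro pair_loopfree_digraph_axioms.intro
        intro: finite_subset)
qed

text \<open>
  The join \<open>G\<^sub>1 + \<dots> + G\<^sub>t\<close> of a family of pairwise vertex-disjoint graphs; by the lemmas
  below it is the iterated binary join.
\<close>

definition graph_Join :: "'a pair_pre_digraph set \<Rightarrow> 'a pair_pre_digraph" where
  "graph_Join \<H> = \<lparr> pverts = (\<Union>H\<in>\<H>. pverts H),
     parcs = (\<Union>H\<in>\<H>. parcs H) \<union>
       {(u, v). \<exists>H\<in>\<H>. \<exists>K\<in>\<H>. H \<noteq> K \<and> u \<in> pverts H \<and> v \<in> pverts K} \<rparr>"

lemma graph_Join_singleton: "graph_Join {G} = G"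
  by (simp add: graph_Join_def)

lemma graph_Join_insert:
  "G \<notin> \<H> \<Longrightarrow> graph_Join (insert G \<H>) = graph_join G (graph_Join \<H>)"
  unfolding graph_Join_def graph_join_def by auto

definition join_decomposition :: "'a pair_pre_digraph \<Rightarrow> 'a pair_pre_digraph set \<Rightarrow> bool" where
  "join_decomposition G \<H> \<longleftrightarrow>
     finite \<H> \<and> card \<H> \<ge> 2 \<and> pairwise (\<lambda>H K. pverts H \<inter> pverts K = {}) \<H> \<and>
     G = graph_Join \<H> \<and> (\<forall>H\<in>\<H>. cograph H \<and> (trivial_graph H \<or> disconnected H))"

definition cocomponent :: "'a pair_pre_digraph \<Rightarrow> 'a pair_pre_digraph \<Rightarrow> bool" where
  "cocomponent G H \<longleftrightarrow>
     (if trivial_graph G \<or> disconnected G then H = G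
      else \<exists>\<H>. join_decomposition G \<H> \<and> H \<in> \<H>)"

definition primary_cocomponent :: "'a pair_pre_digraph \<Rightarrow> 'a pair_pre_digraph \<Rightarrow> bool" where
  "primary_cocomponent G H \<longleftrightarrow>
     cocomponent G H \<and> (\<forall>K. cocomponent G K \<longrightarrow> card (pverts K) \<le> card (pverts H))"

text \<open>
  Since the arc relation of a graph is symmetric and has no parallel arcs, the degree of a
  vertex is its \<^const>\<open>out_degree\<close>.
\<close>

definition isolated_vertex :: "'a pair_pre_digraph \<Rightarrow> 'a \<Rightarrow> bool" where
  "isolated_vertex G v \<longleftrightarrow> v \<in> pverts G \<and> out_degree G v = 0"

definition min_degree :: "'a pair_pre_digraph \<Rightarrow> nat" where
  "min_degree G = Min (out_degree G ` pverts G)"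

definition connectivity :: "'a pair_pre_digraph \<Rightarrow> nat" where
  "connectivity G = (LEAST k. \<exists>S \<subseteq> pverts G. card S = k \<and>
     (disconnected (G \<restriction> (pverts G - S)) \<or> trivial_graph (G \<restriction> (pverts G - S))))"

definition maximally_connected :: "'a pair_pre_digraph \<Rightarrow> bool" where
  "maximally_connected G \<longleftrightarrow> connectivity G = min_degree G"

end

theory Submission
  imports Defs
begin

text \<open>
  A set of vertices of a join of at least two graphs that is not contained in a single joined
  graph induces a connected graph. Hence for a nontrivial connected cograph \<open>G\<close> of order \<open>n\<close> with
  cocomponents \<open>H\<^sub>1, \<dots>, H\<^sub>t\<close>, separating \<open>G\<close> means deleting everything outside some \<open>H\<^sub>i\<close>, so
  \<open>\<kappa>(G) = n - max |H\<^sub>i|\<close>. A vertex \<open>v\<close> of \<open>H\<^sub>i\<close> has degree \<open>n - |H\<^sub>i| + deg\<^bsub>H\<^sub>i\<^esub>(v)\<close>, which equals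
  \<open>\<kappa>(G)\<close> exactly when \<open>H\<^sub>i\<close> is of largest order and \<open>v\<close> is isolated in \<open>H\<^sub>i\<close>. Since \<open>\<kappa>(G)\<close>
  determines the largest order of a cocomponent, uniqueness of the decomposition is not needed.
\<close>

section \<open>Connectedness of graphs\<close>

text \<open>\<open>connected\<close> means strong connectivity of the symmetric closure, and a
  symmetric arc relation is its own symmetric closure.\<close>

lemma connected_iff_rtrancl:
  assumes "pair_sym_digraph G"
  shows "connected (with_proj G) \<longleftrightarrow>
    pverts G \<noteq> {} \<and> (\<forall>u\<in>pverts G. \<forall>v\<in>pverts G. (u, v) \<in> (parcs G)\<^sup>*)"
proof -
  interpret pair_sym_digraph G by fact
  have "(v, u) \<in> parcs G" if "(u, v) \<in> parcs G" for u v
    using that pair_sym_arcs by (auto simp: symmetric_def sym_def)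
  then have "mk_symmetric (with_proj G) = G"
    by (cases G) (auto simp: mk_symmetric_def)
  then show ?thesis
    by (auto simp: connected_def strongly_connected_def reachable_conv)
qed

text \<open>Brings induced subgraphs into a form to which \<open>connected_iff_rtrancl\<close>
  applies.\<close>

lemma induce_subgraph_with_proj:
  "with_proj G \<restriction> W = with_proj \<lparr> pverts = W, parcs = parcs G \<inter> W \<times> W \<rparr>"
  by (auto simp: induce_subgraph_def with_proj_def)

lemma pair_sym_digraph_induce:
  assumes "pair_sym_digraph G"
  shows "pair_sym_digraph \<lparr> pverts = W, parcs = parcs G \<inter> W \<times> W \<rparr>"
proof -
  interpret pair_sym_digraph G by fact
  show ?thesis
    using pair_sym_arcs by unfold_locales (auto simp: symmetric_def sym_def)
qed

lemma cograph_pair_sym_digraph: "cograph G \<Longrightarrow> pair_sym_digraph G"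
  by (simp add: cograph_imp_pair_graph pair_graph.axioms(2) pair_pseudo_graph.axioms(2))

lemma cograph_finite: "cograph G \<Longrightarrow> finite (pverts G)"
  by (simp add: cograph_imp_pair_graph pair_graph.axioms(2) pair_pseudo_graph.axioms(1)
      pair_fin_digraph.pair_finite_verts)

lemma cograph_nonempty: "cograph G \<Longrightarrow> pverts G \<noteq> {}"
  by (simp add: cograph_imp_pair_graph)

lemma cograph_parcs:
  assumes "cograph G"
  shows "parcs G \<subseteq> pverts G \<times> pverts G"
proof -
  interpret pair_sym_digraph G by (rule cograph_pair_sym_digraph[OF assms])
  show ?thesis using wellformed' by auto
qed

lemma cograph_finite_parcs: "cograph G \<Longrightarrow> finite (parcs G)"
  by (rule finite_subset[OF cograph_parcs]) (simp_all add: cograph_finite)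

lemma cograph_induce_verts:
  assumes "cograph G"
  shows "with_proj G \<restriction> pverts G = with_proj G"
  using cograph_parcs[OF assms] by (auto simp: induce_subgraph_def with_proj_def)

lemma disconnected_graph_union:
  assumes "cograph G" "cograph H" "pverts G \<inter> pverts H = {}"
  shows "disconnected (with_proj (graph_union G H))"
proof -
  obtain u v where u: "u \<in> pverts G" and v: "v \<in> pverts H"
    using assms cograph_nonempty by blast
  \<comment> \<open>The vertices of \<open>G\<close> are closed under the arcs of the union, because
    an arc of \<open>H\<close> starts outside \<open>G\<close>.\<close>
  have "w \<in> pverts G" if "(u, w) \<in> (parcs G \<union> parcs H)\<^sup>*" for w
    using that by induction (use u assms cograph_parcs in blast)+
  then have "(u, v) \<notin> (parcs (graph_union G H))\<^sup>*"
    using v assms(3) by (auto simp: graph_union_def)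
  moreover have "pair_sym_digraph (graph_union G H)"
    using assms by (intro cograph_pair_sym_digraph cograph.cograph_union)
  ultimately show ?thesis
    using u v by (auto simp: disconnected_def connected_iff_rtrancl graph_union_def)
qed

section \<open>Join decompositions\<close>

lemma join_decompositionD:
  assumes "join_decomposition G \<H>"
  shows "finite \<H>" "card \<H> \<ge> 2" "G = graph_Join \<H>"
    and "\<And>H. H \<in> \<H> \<Longrightarrow> cograph H"
    and "\<And>H. H \<in> \<H> \<Longrightarrow> trivial_graph (with_proj H) \<or> disconnected (with_proj H)"
    and "\<And>H K. H \<in> \<H> \<Longrightarrow> K \<in> \<H> \<Longrightarrow> H \<noteq> K \<Longrightarrow> pverts H \<inter> pverts K = {}"
  using assms by (auto simp: join_decomposition_def pairwise_def)

lemma graph_Join_Un: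
  assumes "\<And>H K. H \<in> \<A> \<Longrightarrow> K \<in> \<B> \<Longrightarrow> H \<noteq> K"
  shows "graph_Join (\<A> \<union> \<B>) = graph_join (graph_Join \<A>) (graph_Join \<B>)"
proof -
  \<comment> \<open>Members of different families are distinct anyway, so the existentials separate
    and give the products of vertex sets that \<open>graph_join\<close> adds.\<close>
  have AB: "(\<exists>H\<in>\<A>. \<exists>K\<in>\<B>. H \<noteq> K \<and> P H \<and> Q K) \<longleftrightarrow> (\<exists>H\<in>\<A>. P H) \<and> (\<exists>K\<in>\<B>. Q K)" for P Q
    using assms by blast
  have BA: "(\<exists>H\<in>\<B>. \<exists>K\<in>\<A>. H \<noteq> K \<and> P H \<and> Q K) \<longleftrightarrow> (\<exists>H\<in>\<B>. P H) \<and> (\<exists>K\<in>\<A>. Q K)" for P Q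
    using assms by metis
  show ?thesis
    by (auto simp: graph_Join_def graph_join_def bex_Un bex_disj_distrib AB BA)
qed

text \<open>The inductive step for the existence of decompositions: a join of joins flattens, while
  an operand that is trivial or disconnected enters whole, as a singleton family.\<close>

lemma join_decomposition_join:
  assumes "join_decomposition G \<A> \<or> \<A> = {G} \<and> cograph G \<and>
      (trivial_graph (with_proj G) \<or> disconnected (with_proj G))"
    and "join_decomposition H \<B> \<or> \<B> = {H} \<and> cograph H \<and>
      (trivial_graph (with_proj H) \<or> disconnected (with_proj H))"
    and disj: "pverts G \<inter> pverts H = {}"
  shows "join_decomposition (graph_join G H) (\<A> \<union> \<B>)"
proof -
  have A: "finite \<A>" "card \<A> \<ge> 1" "G = graph_Join \<A>"
      "pairwise (\<lambda>H K. pverts H \<inter> pverts K = {}) \<A>"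
      "\<forall>H\<in>\<A>. cograph H \<and> (trivial_graph (with_proj H) \<or> disconnected (with_proj H))"
    using assms(1) by (auto simp: join_decomposition_def graph_Join_singleton)
  have B: "finite \<B>" "card \<B> \<ge> 1" "H = graph_Join \<B>"
      "pairwise (\<lambda>H K. pverts H \<inter> pverts K = {}) \<B>"
      "\<forall>H\<in>\<B>. cograph H \<and> (trivial_graph (with_proj H) \<or> disconnected (with_proj H))"
    using assms(2) by (auto simp: join_decomposition_def graph_Join_singleton)
  have cross: "pverts K \<inter> pverts L = {}" if "K \<in> \<A>" "L \<in> \<B>" for K L
  proof -
    have "pverts K \<subseteq> pverts G" "pverts L \<subseteq> pverts H"
      using that by (auto simp: A(3) B(3) graph_Join_def)
    then show ?thesis using disj by blast
  qed
  \<comment> \<open>Disjoint vertex sets force distinct graphs because cographs are nonempty; hence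
    the cardinalities of the two families add up to at least 2.\<close>
  have ne: "K \<noteq> L" if "K \<in> \<A>" "L \<in> \<B>" for K L
    using cross[OF that] that A(5) cograph_nonempty by auto
  then have "\<A> \<inter> \<B> = {}" by blast
  then have "card (\<A> \<union> \<B>) \<ge> 2"
    using A B by (simp add: card_Un_disjoint)
  moreover have "graph_join G H = graph_Join (\<A> \<union> \<B>)"
    using graph_Join_Un[OF ne] A(3) B(3) by simp
  moreover have "pairwise (\<lambda>H K. pverts H \<inter> pverts K = {}) (\<A> \<union> \<B>)"
    using A(4) B(4) cross unfolding pairwise_def by (metis Int_commute Un_iff)
  ultimately show ?thesis
    using A B unfolding join_decomposition_def by blast
qed

text \<open>Of the three constructions only the join escapes both excluded cases.\<close>

lemma cograph_join_decomposition:
  assumes "cograph G" "\<not> trivial_graph (with_proj G)" "\<not> disconnected (with_proj G)"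
  obtains \<H> where "join_decomposition G \<H>"
proof -
  have "trivial_graph (with_proj G) \<or> disconnected (with_proj G) \<or> (\<exists>\<H>. join_decomposition G \<H>)"
    using assms(1)
  proof (induction rule: cograph.induct)
    case (cograph_K1 v)
    then show ?case by (simp add: trivial_graph_def)
  next
    case (cograph_union G H)
    then show ?case by (simp add: disconnected_graph_union)
  next
    case (cograph_join G H)
    then show ?case using join_decomposition_join by blast
  qed
  then show ?thesis using assms that by blast
qed

section \<open>Connectivity and degrees of joins\<close>

text \<open>By disjointness \<open>u\<close> lies in no member but \<open>H\<close>, so it is joined
  to every vertex of the other members. Induced subgraphs, paths and degrees are read off from this
  description.\<close>

lemma join_decomposition_arc:
  assumes dec: "join_decomposition G \<H>" and H: "H \<in> \<H>" and u: "u \<in> pverts H"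
  shows "(u, v) \<in> parcs G \<longleftrightarrow> (u, v) \<in> parcs H \<or> v \<in> pverts G - pverts H"
proof -
  note D = join_decompositionD[OF dec]
  have eq: "K = H" if "K \<in> \<H>" "x \<in> pverts K" "x \<in> pverts H" for K x
    using D(6)[OF that(1) H] that by blast
  have "(u, v) \<in> parcs G \<longleftrightarrow> (\<exists>K\<in>\<H>. (u, v) \<in> parcs K) \<or>
      (\<exists>K\<in>\<H>. \<exists>L\<in>\<H>. K \<noteq> L \<and> u \<in> pverts K \<and> v \<in> pverts L)"
    by (simp add: D(3) graph_Join_def)
  also have "(\<exists>K\<in>\<H>. (u, v) \<in> parcs K) \<longleftrightarrow> (u, v) \<in> parcs H"
    using eq H u cograph_parcs[OF D(4)] by blast
  also have "(\<exists>K\<in>\<H>. \<exists>L\<in>\<H>. K \<noteq> L \<and> u \<in> pverts K \<and> v \<in> pverts L) \<longleftrightarrow>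
      (\<exists>L\<in>\<H>. H \<noteq> L \<and> v \<in> pverts L)"
    using eq H u by blast
  also have "\<dots> \<longleftrightarrow> v \<in> (\<Union>L\<in>\<H>. pverts L) - pverts H"
    unfolding Diff_iff UN_iff using eq by metis
  also have "(\<Union>L\<in>\<H>. pverts L) = pverts G"
    by (simp add: D(3) graph_Join_def)
  finally show ?thesis .
qed

lemma join_decomposition_subset:
  assumes "join_decomposition G \<H>" "H \<in> \<H>"
  shows "pverts H \<subseteq> pverts G"
  using assms(2) unfolding join_decompositionD(3)[OF assms(1)] graph_Join_def by auto

lemma join_decomposition_induce:
  assumes dec: "join_decomposition G \<H>" and H: "H \<in> \<H>"
  shows "with_proj G \<restriction> pverts H = with_proj H"
proof -
  have "parcs G \<inter> pverts H \<times> pverts H = parcs H"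
    using join_decomposition_arc[OF dec H] cograph_parcs[OF join_decompositionD(4)[OF dec H]]
    by auto
  then show ?thesis by (simp add: induce_subgraph_with_proj)
qed

text \<open>Otherwise any two vertices of \<open>W\<close> are linked inside \<open>W\<close>:
  directly if they lie in different members, and through a vertex of another member if they share
  one.\<close>

lemma disconnected_induce_join:
  assumes "cograph G" and dec: "join_decomposition G \<H>" and W: "W \<subseteq> pverts G"
    and disc: "disconnected (with_proj G \<restriction> W)"
  shows "\<exists>H\<in>\<H>. W \<subseteq> pverts H"
proof (rule ccontr)
  assume nsub: "\<not> (\<exists>H\<in>\<H>. W \<subseteq> pverts H)"
  let ?A = "parcs G \<inter> W \<times> W"
  have part: "\<exists>H\<in>\<H>. u \<in> pverts H" if "u \<in> W" for u
    using W that by (auto simp: join_decompositionD(3)[OF dec] graph_Join_def)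
  note arc = join_decomposition_arc[OF dec]
  have "(u, v) \<in> ?A\<^sup>*" if u: "u \<in> W" and v: "v \<in> W" for u v
  proof -
    obtain H where H: "H \<in> \<H>" "u \<in> pverts H" using part u by blast
    show ?thesis
    proof (cases "v \<in> pverts H")
      case True
      \<comment> \<open>\<open>W\<close> is not contained in \<open>H\<close>, so it offers a detour
        vertex adjacent to both \<open>u\<close> and \<open>v\<close>.\<close>
      obtain w where w: "w \<in> W" "w \<notin> pverts H" using nsub H by blast
      obtain K where K: "K \<in> \<H>" "w \<in> pverts K" using part w by blast
      have "v \<notin> pverts K" using join_decompositionD(6)[OF dec H(1) K(1)] K w True by blast
      then have "(u, w) \<in> ?A" "(w, v) \<in> ?A"
        using arc[OF H] arc[OF K] u v w W by auto
      then show ?thesis by (meson r_into_rtrancl rtrancl_trans)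
    next
      case False
      then have "(u, v) \<in> ?A" using arc[OF H] u v W by auto
      then show ?thesis by blast
    qed
  qed
  then have "\<not> disconnected (with_proj G \<restriction> W)"
    using pair_sym_digraph_induce[OF cograph_pair_sym_digraph[OF \<open>cograph G\<close>]]
    by (auto simp: disconnected_def induce_subgraph_with_proj connected_iff_rtrancl)
  with disc show False by contradiction
qed

lemma connectivity_le:
  assumes "S \<subseteq> pverts G"
    and "disconnected (with_proj G \<restriction> (pverts G - S)) \<or> trivial_graph (with_proj G \<restriction> (pverts G - S))"
  shows "connectivity G \<le> card S"
  unfolding connectivity_def using assms by (intro Least_le exI[of _ S]) simp

text \<open>Deleting all vertices outside \<open>H\<close> leaves \<open>H\<close> itself, which is
  trivial or disconnected. The additive form avoids truncated subtraction.\<close>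

lemma connectivity_join_le:
  assumes "cograph G" and dec: "join_decomposition G \<H>" and H: "H \<in> \<H>"
  shows "connectivity G + card (pverts H) \<le> card (pverts G)"
proof -
  have sub: "pverts H \<subseteq> pverts G" by (rule join_decomposition_subset[OF dec H])
  then have "pverts G - (pverts G - pverts H) = pverts H" by blast
  then have "connectivity G \<le> card (pverts G - pverts H)"
    using join_decompositionD(5)[OF dec H] join_decomposition_induce[OF dec H]
    by (intro connectivity_le) auto
  also have "\<dots> = card (pverts G) - card (pverts H)"
    using sub cograph_finite[OF \<open>cograph G\<close>] by (meson card_Diff_subset finite_subset)
  finally show ?thesis
    using card_mono[OF cograph_finite[OF \<open>cograph G\<close>] sub] by simp
qed

text \<open>What a minimum separating set leaves fits into one member, so the set has at least as
  many vertices as lie outside that member; the previous bound gives equality.\<close>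

lemma connectivity_join_attained:
  assumes "cograph G" and dec: "join_decomposition G \<H>"
  obtains H where "H \<in> \<H>" "connectivity G + card (pverts H) = card (pverts G)"
proof -
  let ?sep = "\<lambda>S. disconnected (with_proj G \<restriction> (pverts G - S)) \<or>
    trivial_graph (with_proj G \<restriction> (pverts G - S))"
  \<comment> \<open>Deleting all vertices but one leaves a trivial graph, so the
    \<open>LEAST\<close> in \<open>connectivity\<close> ranges over a nonempty set.\<close>
  obtain v where v: "v \<in> pverts G" using cograph_nonempty[OF \<open>cograph G\<close>] by blast
  then have "pverts G - (pverts G - {v}) = {v}" by blast
  then have "?sep (pverts G - {v})" by (simp add: trivial_graph_def)
  then have "\<exists>S \<subseteq> pverts G. card S = card (pverts G - {v}) \<and> ?sep S"
    by (intro exI[of _ "pverts G - {v}"]) simp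
  then have "\<exists>S \<subseteq> pverts G. card S = connectivity G \<and> ?sep S"
    unfolding connectivity_def by (rule LeastI)
  then obtain S where S: "S \<subseteq> pverts G" "card S = connectivity G" "?sep S" by blast
  have "\<exists>H\<in>\<H>. pverts G - S \<subseteq> pverts H"
  proof (cases "disconnected (with_proj G \<restriction> (pverts G - S))")
    case True
    then show ?thesis using disconnected_induce_join[OF assms] by blast
  next
    case False
    then obtain w where w: "pverts G - S = {w}"
      using S(3) by (auto simp: trivial_graph_def card_1_singleton_iff)
    then have "w \<in> pverts G" by blast
    then have "\<exists>H\<in>\<H>. w \<in> pverts H"
      by (auto simp: join_decompositionD(3)[OF dec] graph_Join_def)
    then show ?thesis using w by simp
  qed
  then obtain H where H: "H \<in> \<H>" "pverts G - S \<subseteq> pverts H" by blast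
  have fin: "finite (pverts G)" by (rule cograph_finite[OF \<open>cograph G\<close>])
  have "card (pverts G) = card S + card (pverts G - S)"
    using S(1) fin by (metis Diff_disjoint Diff_partition card_Un_disjoint finite_Diff finite_subset)
  also have "card (pverts G - S) \<le> card (pverts H)"
    using H(2) cograph_finite[OF join_decompositionD(4)[OF dec H(1)]] by (rule card_mono[rotated])
  finally have "connectivity G + card (pverts H) = card (pverts G)"
    using connectivity_join_le[OF assms H(1)] S(2) by simp
  with H(1) show ?thesis by (rule that)
qed

lemma out_degree_join:
  assumes "cograph G" and dec: "join_decomposition G \<H>" and H: "H \<in> \<H>" and v: "v \<in> pverts H"
  shows "out_degree (with_proj G) v + card (pverts H) =
    card (pverts G) + out_degree (with_proj H) v"
proof -
  have sub: "pverts H \<subseteq> pverts G" by (rule join_decomposition_subset[OF dec H])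
  have fin: "finite (pverts G)" by (rule cograph_finite[OF \<open>cograph G\<close>])
  have cH: "cograph H" by (rule join_decompositionD(4)[OF dec H])
  let ?O = "out_arcs (with_proj H) v"
  let ?N = "{v} \<times> (pverts G - pverts H)"
  \<comment> \<open>The arcs leaving \<open>v\<close> split according to whether their head lies in
    \<open>H\<close>.\<close>
  have "out_arcs (with_proj G) v = ?O \<union> ?N"
    using join_decomposition_arc[OF dec H v] by (auto simp: out_arcs_def)
  moreover have "finite ?O" using cograph_finite_parcs[OF cH] by (simp add: out_arcs_def)
  moreover have "?O \<inter> ?N = {}" using cograph_parcs[OF cH] by (auto simp: out_arcs_def)
  ultimately have "out_degree (with_proj G) v = out_degree (with_proj H) v + card ?N"
    unfolding out_degree_def using fin by (simp add: card_Un_disjoint)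
  moreover have "card ?N = card (pverts G) - card (pverts H)"
    using sub fin by (simp add: card_cartesian_product card_Diff_subset finite_subset)
  ultimately show ?thesis using card_mono[OF fin sub] by simp
qed

lemma min_degree_le:
  assumes "cograph G" "v \<in> pverts G"
  shows "min_degree G \<le> out_degree (with_proj G) v"
  using assms by (simp add: min_degree_def cograph_finite)

lemma min_degree_attained:
  assumes "cograph G"
  obtains v where "v \<in> pverts G" "out_degree (with_proj G) v = min_degree G"
proof -
  have "min_degree G \<in> out_degree (with_proj G) ` pverts G"
    unfolding min_degree_def using assms cograph_finite cograph_nonempty by (intro Min_in) auto
  then show ?thesis using that by auto
qed

text \<open>A vertex of minimum degree in a member \<open>H\<close> is adjacent to everything
  outside \<open>H\<close>, and deleting these vertices separates \<open>G\<close>.\<close>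

lemma connectivity_le_min_degree_join:
  assumes "cograph G" and dec: "join_decomposition G \<H>"
  shows "connectivity G \<le> min_degree G"
proof -
  obtain v where v: "v \<in> pverts G" "out_degree (with_proj G) v = min_degree G"
    using min_degree_attained[OF \<open>cograph G\<close>] .
  then obtain H where H: "H \<in> \<H>" "v \<in> pverts H"
    by (auto simp: join_decompositionD(3)[OF dec] graph_Join_def)
  show ?thesis
    using connectivity_join_le[OF assms H(1)] out_degree_join[OF assms H] v by simp
qed

section \<open>Primary cocomponents and maximal connectivity\<close>

lemma cocomponent_join_iff:
  assumes "\<not> trivial_graph (with_proj G)" "\<not> disconnected (with_proj G)"
  shows "cocomponent G H \<longleftrightarrow> (\<exists>\<H>. join_decomposition G \<H> \<and> H \<in> \<H>)"
  using assms by (simp add: cocomponent_def)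

text \<open>The right-hand side does not mention a decomposition: all of them have the same largest order.\<close>

lemma primary_cocomponent_join_iff:
  assumes G: "cograph G" "\<not> trivial_graph (with_proj G)" "\<not> disconnected (with_proj G)"
  shows "primary_cocomponent G H \<longleftrightarrow>
    cocomponent G H \<and> connectivity G + card (pverts H) = card (pverts G)"
proof -
  note coc = cocomponent_join_iff[OF G(2,3)]
  have le: "connectivity G + card (pverts K) \<le> card (pverts G)" if "cocomponent G K" for K
    using that connectivity_join_le[OF G(1)] by (auto simp: coc)
  obtain \<H> where dec: "join_decomposition G \<H>"
    using cograph_join_decomposition[OF G] .
  \<comment> \<open>\<open>M\<close> attains the bound \<open>le\<close>, which holds for the
    members of every decomposition; hence its order is the maximum over all cocomponents.\<close>
  obtain M where M: "M \<in> \<H>" "connectivity G + card (pverts M) = card (pverts G)"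
    using connectivity_join_attained[OF G(1) dec] .
  then have "cocomponent G M" using dec by (auto simp: coc)
  then show ?thesis
    unfolding primary_cocomponent_def using le M(2)
    by (metis add_le_cancel_left le_antisym)
qed

theorem theorem5:
  fixes G :: "'a pair_pre_digraph"
  assumes "cograph G"
  shows "maximally_connected G \<longleftrightarrow>
    (\<exists>H. primary_cocomponent G H \<and> (\<exists>v. isolated_vertex H v))"
proof (cases "trivial_graph (with_proj G) \<or> disconnected (with_proj G)")
  case True
  \<comment> \<open>The empty set already separates, and \<open>G\<close> is its own only
    cocomponent, so the claim reduces to minimum degree 0.\<close>
  then have "connectivity G \<le> card ({} :: 'a set)"
    by (intro connectivity_le) (auto simp: cograph_induce_verts[OF assms])
  then have "connectivity G = 0" by simp
  moreover have "min_degree G = 0 \<longleftrightarrow> (\<exists>v. isolated_vertex G v)"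
    using min_degree_attained[OF assms] min_degree_le[OF assms]
    unfolding isolated_vertex_def by (metis le_zero_eq)
  moreover have "primary_cocomponent G H \<longleftrightarrow> H = G" for H
    using True by (auto simp: primary_cocomponent_def cocomponent_def)
  ultimately show ?thesis by (auto simp: maximally_connected_def)
next
  case False
  then have G: "cograph G" "\<not> trivial_graph (with_proj G)" "\<not> disconnected (with_proj G)"
    using assms by auto
  note coc = cocomponent_join_iff[OF G(2,3)]
  show ?thesis
  proof
    assume "maximally_connected G"
    obtain \<H> where dec: "join_decomposition G \<H>"
      using cograph_join_decomposition[OF G] .
    obtain v where v: "v \<in> pverts G" "out_degree (with_proj G) v = min_degree G"
      using min_degree_attained[OF assms] .
    then obtain H where H: "H \<in> \<H>" "v \<in> pverts H"
      by (auto simp: join_decompositionD(3)[OF dec] graph_Join_def)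
    have "connectivity G + card (pverts H) = card (pverts G) + out_degree (with_proj H) v"
      using out_degree_join[OF assms dec H] v(2) \<open>maximally_connected G\<close>
      by (simp add: maximally_connected_def)
    \<comment> \<open>The left side of the equation is at most the order of \<open>G\<close>, so the
      degree of \<open>v\<close> in \<open>H\<close> vanishes and \<open>H\<close> attains the
      largest order.\<close>
    with connectivity_join_le[OF assms dec H(1)]
    have "connectivity G + card (pverts H) = card (pverts G)" "out_degree (with_proj H) v = 0"
      by auto
    then have "primary_cocomponent G H" "isolated_vertex H v"
      using dec H by (auto simp: primary_cocomponent_join_iff[OF G] coc isolated_vertex_def)
    then show "\<exists>H. primary_cocomponent G H \<and> (\<exists>v. isolated_vertex H v)" by blast
  next
    assume "\<exists>H. primary_cocomponent G H \<and> (\<exists>v. isolated_vertex H v)"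
    then obtain H \<H> v where dec: "join_decomposition G \<H>" and H: "H \<in> \<H>"
      and card: "connectivity G + card (pverts H) = card (pverts G)"
      and v: "v \<in> pverts H" "out_degree (with_proj H) v = 0"
      by (auto simp: primary_cocomponent_join_iff[OF G] coc isolated_vertex_def)
    have "v \<in> pverts G" using join_decomposition_subset[OF dec H] v(1) by blast
    \<comment> \<open>Being isolated in \<open>H\<close>, the vertex \<open>v\<close> has as many
      neighbours in \<open>G\<close> as there are vertices outside \<open>H\<close>, and by
      \<open>card\<close> this number is the connectivity.\<close>
    then have "min_degree G \<le> connectivity G"
      using min_degree_le[OF assms] out_degree_join[OF assms dec H v(1)] v(2) card by fastforce
    then show "maximally_connected G"
      using connectivity_le_min_degree_join[OF assms dec] by (simp add: maximally_connected_def)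
  qed
qed

end
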